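(* Let $d\ge 2$, let $f_1,f_2\in\Omega$ be height functions, $g:=f_1-f_2$, and $(a_i,T_i):=\Phi(f_i)=(f_i(\mathbf 0),T(f_i))$ for $i\in\{1,2\}$. Let $M\subset V_g\subset E^d$ be a union of $g$-boundaries. Then the sets $T_i':=T_i\ominus M$ are tilings for $i\in\{1,2\}$. Write $f_1'$ and $f_2'$ for the unique height functions such that $\Phi(f_i')=(a_i,T_i')$ and define $g'=f_1'-f_2'$. Then $G_{g'}=G_g$ and $\operatorname{LSD}(g')=\operatorname{LSD}(g)$. Moreover, $\nabla g'$ and $\nabla g$ are the same except that the $g$-boundaries contained in $M$ have reversed orientation, that is, $\nabla g'=(-1)^{1_M}\cdot\nabla g$: for every edge $\{\mathbf x,\mathbf y\}\in E^d$ one has $g'(\mathbf y)-g'(\mathbf x)=-(g(\mathbf y)-g(\mathbf x))$ if $\{\mathbf x,\mathbf y\}\in M$ and $g'(\mathbf y)-g'(\mathbf x)=g(\mathbf y)-g(\mathbf x)$ otherwise.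
   Context: Fix an integer $d\ge 2$. Let $\mathbf e_1,\dots,\mathbf e_{d+1}$ be the standard basis of $\mathbb R^{d+1}$, $\mathbf n=\mathbf e_1+\dots+\mathbf e_{d+1}$, $H=\mathbf n^\perp\subset\mathbb R^{d+1}$, $P$ the orthogonal projection onto $H$, and $\mathbf g_i=P\mathbf e_i=\mathbf e_i-\mathbf n/(d+1)$. The simplicial lattice $(X^d,E^d)$ is the graph with vertex set $X^d=P(\mathbb Z^{d+1})\subset H$ (equivalently $\mathbb Z^{d+1}/\mathbb Z\mathbf n$) and edges $\{\mathbf x,\mathbf x+\mathbf g_i\}$, $\mathbf x\in X^d$, $1\le i\le d+1$. A height function is a function $f:X^d\to\mathbb Z$ with $f(\mathbf 0)\in(d+1)\mathbb Z$ and $f(\mathbf x+\mathbf g_i)-f(\mathbf x)\in\{1,-d\}$ for all $\mathbf x\in X^d$ and $i$. $\Omega$ is the set of height functions. For $f\in\Omega$, $T(f):=\{\{\mathbf x,\mathbf x+\mathbf g_i\}\in E^d: f(\mathbf x+\mathbf g_i)-f(\mathbf x)=-d\}$. A simplicial loop is a closed path $(\mathbf s_k)_{0\le k\le d+1}$ in $X^d$ with $\mathbf s_k=\mathbf s_{k-1}+\mathbf g_{\xi(k)}$ for some permutation $\xi$ of $\{1,\dots,d+1\}$. A tiling is a set $T\subset E^d$ containing exactly one edge of every simplicial loop; $\Theta$ is the set of tilings. The map $\Phi:\Omega\to(d+1)\mathbb Z\times\Theta$, $f\mapsto(f(\mathbf 0),T(f))$ is a bijection. $A\ominus B$ denotes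 symmetric difference. For $f_1,f_2\in\Omega$ and $g=f_1-f_2$ put $V_g:=T(f_1)\ominus T(f_2)=\{e\in E^d: g\text{ is not constant on }e\}$. The boundary graph $G_g$ has vertex set $V_g$, and two elements of $V_g$ are adjacent if some simplicial loop traverses both. A $g$-boundary is a connected component of $G_g$, considered as a subset of $V_g\subset E^d$. A $g$-level set is a connected component of the graph $(X^d,E^d\smallsetminus V_g)$, considered as a subset of $X^d$. For $e\in V_g$, $\mathbf x_g^-(e)$ and $\mathbf x_g^+(e)$ are the endpoints of $e$ at which $g$ takes the smaller, respectively larger, value; $\mathbf x_g^\pm(E)=\{\mathbf x_g^\pm(e):e\in E\}$. $\operatorname{LSD}(g)$ is the undirected graph whose vertices are the $g$-level sets and whose edges are the $g$-boundaries, where a $g$-boundary $E$ connects the $g$-level set containing $\mathbf x_g^-(E)$ to the one containing $\mathbf x_g^+(E)$ (it is known that this is well-defined). *)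

theory Defs
  imports "HOL-Analysis.Analysis"
begin

text \<open>
  The ambient space \<open>\<real>\<^bsup>d+1\<^esup>\<close> is \<^typ>\<open>real^'n\<close> with \<open>CARD('n) = d + 1\<close>; the elements of \<^typ>\<open>'n\<close>
  play the role of the coordinate indices \<open>1, \<dots>, d + 1\<close>.
\<close>

section \<open>The simplicial lattice\<close>

definition nvec :: "real^'n" where
  "nvec = (\<Sum>i\<in>UNIV. axis i 1)"

definition H :: "(real^'n) set" where
  "H = {x. x \<bullet> nvec = 0}"

definition P :: "real^'n \<Rightarrow> real^'n" where
  "P x = x - ((x \<bullet> nvec) / (nvec \<bullet> (nvec :: real^'n))) *\<^sub>R nvec"

definition gvec :: "'n \<Rightarrow> real^'n" where
  "gvec i = P (axis i 1)"

definition lattice_points :: "(real^'n) set" where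
  "lattice_points = P ` {z. \<forall>i. z $ i \<in> \<int>}"

definition lattice_edges :: "(real^'n) set set" where
  "lattice_edges = {{x, x + gvec i} | x i. x \<in> lattice_points}"

lemma nvec_nth [simp]: "nvec $ i = 1"
  by (simp add: nvec_def axis_def)

lemma nvec_inner_nvec: "(nvec :: real^'n) \<bullet> nvec = real CARD('n)"
  by (simp add: inner_vec_def)

text \<open>\<^const>\<open>P\<close> is the orthogonal projection onto \<^const>\<open>H\<close>.\<close>

lemma P_in_H: "P x \<in> H"
  by (simp add: P_def H_def inner_diff_left nvec_inner_nvec)

lemma P_orthogonal: "y \<in> H \<Longrightarrow> (x - P x) \<bullet> y = 0"
  by (simp add: P_def H_def inner_commute)

lemma gvec_eq: "gvec i = axis i 1 - (1 / real CARD('n)) *\<^sub>R (nvec :: real^'n)"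
  by (simp add: gvec_def P_def nvec_inner_nvec inner_axis')

section \<open>Height functions and tilings\<close>

text \<open>
  Functions on the lattice are represented by total functions on \<^typ>\<open>real^'n\<close>. Height functions
  are required to be \<^const>\<open>extensional\<close> on the lattice, so that equality of height functions is
  equality on \<^const>\<open>lattice_points\<close>.
\<close>

definition height_functions :: "(real^'n \<Rightarrow> int) set" where
  "height_functions = {f \<in> extensional lattice_points.
     int CARD('n) dvd f 0 \<and>
     (\<forall>x\<in>lattice_points. \<forall>i. f (x + gvec i) - f x \<in> {1, - (int CARD('n) - 1)})}"

definition tiling_of :: "(real^'n \<Rightarrow> int) \<Rightarrow> (real^'n) set set" where
  "tiling_of f = {{x, x + gvec i} | x i.
     x \<in> lattice_points \<and> f (x + gvec i) - f x = - (int CARD('n) - 1)}"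

text \<open>Only the values \<open>s 0, \<dots>, s (d + 1)\<close> of a path \<open>s\<close> are relevant.\<close>

definition simplicial_loop :: "(nat \<Rightarrow> real^'n) \<Rightarrow> bool" where
  "simplicial_loop s \<longleftrightarrow>
     (\<forall>k\<le>CARD('n). s k \<in> lattice_points) \<and>
     s CARD('n) = s 0 \<and>
     (\<exists>\<xi>. bij_betw \<xi> {1..CARD('n)} (UNIV :: 'n set) \<and>
          (\<forall>k\<in>{1..CARD('n)}. s k = s (k - 1) + gvec (\<xi> k)))"

definition loop_edges :: "(nat \<Rightarrow> real^'n) \<Rightarrow> (real^'n) set set" where
  "loop_edges s = {{s (k - 1), s k} | k. k \<in> {1..CARD('n)}}"

definition tilings :: "(real^'n) set set set" where
  "tilings = {T. T \<subseteq> lattice_edges \<and> (\<forall>s. simplicial_loop s \<longrightarrow> (\<exists>!e. e \<in> loop_edges s \<and> e \<in> T))}"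

definition Phi :: "(real^'n \<Rightarrow> int) \<Rightarrow> int \<times> (real^'n) set set" where
  "Phi f = (f 0, tiling_of f)"

section \<open>Boundaries and level sets\<close>

text \<open>
  Simple graphs are pairs of a vertex set and a set of two-element sets of vertices;
  connected components are returned as vertex sets.
\<close>

definition connected_comps :: "'v set \<times> 'v set set \<Rightarrow> 'v set set" where
  "connected_comps G =
     fst G // {(u, v). u \<in> fst G \<and> v \<in> fst G \<and> (u, v) \<in> {(a, b). {a, b} \<in> snd G}\<^sup>*}"

definition V :: "(real^'n \<Rightarrow> int) \<Rightarrow> (real^'n) set set" where
  "V g = {e \<in> lattice_edges. \<not> g constant_on e}"

definition boundary_graph ::
  "(real^'n \<Rightarrow> int) \<Rightarrow> (real^'n) set set \<times> (real^'n) set set set" where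
  "boundary_graph g = (V g,
     {{e, e'} | e e'. e \<in> V g \<and> e' \<in> V g \<and> e \<noteq> e' \<and>
        (\<exists>s. simplicial_loop s \<and> e \<in> loop_edges s \<and> e' \<in> loop_edges s)})"

definition boundaries :: "(real^'n \<Rightarrow> int) \<Rightarrow> (real^'n) set set set" where
  "boundaries g = connected_comps (boundary_graph g)"

definition level_sets :: "(real^'n \<Rightarrow> int) \<Rightarrow> (real^'n) set set" where
  "level_sets g = connected_comps (lattice_points, lattice_edges - V g)"

definition xminus :: "(real^'n \<Rightarrow> int) \<Rightarrow> (real^'n) set \<Rightarrow> real^'n" where
  "xminus g e = (ARG_MIN g x. x \<in> e)"

definition xplus :: "(real^'n \<Rightarrow> int) \<Rightarrow> (real^'n) set \<Rightarrow> real^'n" where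
  "xplus g e = (ARG_MAX g x. x \<in> e)"

text \<open>
  An undirected graph whose edges are abstract objects is a triple of its vertices, its edges, and
  its incidence relation, which pairs every edge with the set of its endpoints.
\<close>

definition LSD :: "(real^'n \<Rightarrow> int) \<Rightarrow>
  (real^'n) set set \<times> (real^'n) set set set \<times> ((real^'n) set set \<times> (real^'n) set set) set" where
  "LSD g = (level_sets g, boundaries g,
     {(E, {A, B}) | E A B. E \<in> boundaries g \<and> A \<in> level_sets g \<and> B \<in> level_sets g \<and>
        xminus g ` E \<subseteq> A \<and> xplus g ` E \<subseteq> B})"

section \<open>The two descriptions of \<^const>\<open>V\<close> agree\<close>

lemma edge_orientation:
  fixes x y :: "real^'n"
  assumes card: "CARD('n) \<ge> 3" and eq: "{x, x + gvec i} = {y, y + gvec j}"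
  shows "x = y \<and> i = j"
proof -
  have nz: "gvec a + gvec b \<noteq> (0 :: real^'n)" for a b :: 'n
  proof
    assume *: "gvec a + gvec b = (0 :: real^'n)"
    have "card {a, b} < CARD('n)"
      using card card_insert_le_m1[of 2 "{b}" a] by auto
    then have "{a, b} \<noteq> UNIV" by force
    then obtain k where k: "k \<noteq> a" "k \<noteq> b" by blast
    have "(gvec a + gvec b :: real^'n) $ k = - 2 / real CARD('n)"
      using k by (simp add: gvec_eq axis_def)
    with * show False by simp
  qed
  have inj: "a = b" if "gvec a = (gvec b :: real^'n)" for a b :: 'n
    using that by (simp add: gvec_eq axis_eq_axis)
  from eq consider "x = y" "x + gvec i = y + gvec j" | "x = y + gvec j" "x + gvec i = y"
    by (auto simp: doubleton_eq_iff)
  then show ?thesis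
  proof cases
    case 1 then show ?thesis using inj by auto
  next
    case 2
    then have "gvec j + gvec i = (0 :: real^'n)" by (simp add: add.assoc)
    with nz show ?thesis by blast
  qed
qed

lemma V_diff_eq:
  fixes f1 f2 :: "real^'n \<Rightarrow> int"
  assumes card: "CARD('n) \<ge> 3"
    and f: "f1 \<in> height_functions" "f2 \<in> height_functions"
  shows "V (\<lambda>x. f1 x - f2 x) = sym_diff (tiling_of f1) (tiling_of f2)"
proof -
  have T: "{x, x + gvec i} \<in> tiling_of f \<longleftrightarrow> f (x + gvec i) - f x = - (int CARD('n) - 1)"
    if "x \<in> lattice_points" for x i and f :: "real^'n \<Rightarrow> int"
    using that edge_orientation[OF card] unfolding tiling_of_def by blast
  have main: "{x, x + gvec i} \<in> V (\<lambda>x. f1 x - f2 x) \<longleftrightarrow>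
      {x, x + gvec i} \<in> sym_diff (tiling_of f1) (tiling_of f2)"
    if x: "x \<in> lattice_points" for x :: "real^'n" and i
  proof -
    have "{x, x + gvec i} \<in> V (\<lambda>x. f1 x - f2 x) \<longleftrightarrow>
        f1 (x + gvec i) - f1 x \<noteq> f2 (x + gvec i) - f2 x"
      using x unfolding V_def lattice_edges_def constant_on_def by auto
    moreover have "f1 (x + gvec i) - f1 x \<in> {1, - (int CARD('n) - 1)}"
      "f2 (x + gvec i) - f2 x \<in> {1, - (int CARD('n) - 1)}"
      using f x unfolding height_functions_def by blast+
    ultimately show ?thesis
      using card T[OF x, of i f1] T[OF x, of i f2] by auto
  qed
  have sub: "V (\<lambda>x. f1 x - f2 x) \<subseteq> lattice_edges"
    "sym_diff (tiling_of f1) (tiling_of f2) \<subseteq> lattice_edges"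
    unfolding V_def tiling_of_def lattice_edges_def by blast+
  show ?thesis
  proof (rule set_eqI)
    fix e
    show "e \<in> V (\<lambda>x. f1 x - f2 x) \<longleftrightarrow> e \<in> sym_diff (tiling_of f1) (tiling_of f2)"
    proof (cases "e \<in> lattice_edges")
      case True
      then obtain x i where "x \<in> lattice_points" "e = {x, x + gvec i}"
        unfolding lattice_edges_def by blast
      then show ?thesis using main by simp
    next
      case False then show ?thesis using sub by blast
    qed
  qed
qed

end

theory Submission
  imports Defs "HOL-Library.Multiset"
begin

text \<open>
  A simplicial loop meets each of two tilings \<open>T\<^sub>1\<close>, \<open>T\<^sub>2\<close> in one edge. So it meets
  \<open>T\<^sub>1 \<ominus> T\<^sub>2\<close> either not at all or in two edges, one from each tiling, and these two lie in the
  same boundary. Toggling a union of boundaries therefore exchanges the two edges or leaves them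
  alone, and both sets stay tilings.

  A tiling is the same thing as a discrete gradient: the weights \<open>-d\<close> on the edges of the tiling
  and \<open>1\<close> elsewhere sum to \<open>0\<close> along every simplicial loop. Comparing two loops that differ in
  the order of their first two steps shows that the total weight of a path depends only on the
  multiset of its steps, and two multisets of steps with the same endpoint differ by full loops;
  hence the weights have a potential. On \<open>M\<close> the two gradients are exchanged, so the gradient of
  the difference changes sign there and nowhere else.
\<close>

section \<open>Paths in the simplicial lattice\<close>

lemma gvec_nth: "(gvec i :: real^'n) $ j = (if i = j then 1 else 0) - 1 / real CARD('n)"
  by (simp add: gvec_eq axis_def)

text \<open>An endpoint thus determines the multiset of steps up to adding one constant to all
  multiplicities; comparing two paths rests on this.\<close>

lemma steps_nth:
  "(sum_list (map gvec xs) :: real^'n) $ j = real (count (mset xs) j) - real (length xs) / real CARD('n)"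
  by (induction xs) (auto simp: gvec_nth add_divide_distrib)

lemma P_nth: "P z $ j = z $ j - (\<Sum>i\<in>UNIV. z $ i) / real CARD('n)" for z :: "real^'n"
  by (simp add: P_def nvec_inner_nvec) (simp add: inner_vec_def)

lemma P_add: "P (x + y) = P x + P y"
  by (simp add: P_def inner_add_left add_divide_distrib scaleR_add_left)

lemma zero_in_lattice_points: "(0::real^'n) \<in> lattice_points"
proof -
  have "P (0::real^'n) \<in> P ` {z. \<forall>i. z $ i \<in> \<int>}" by (rule imageI) simp
  then show ?thesis by (simp add: P_def lattice_points_def)
qed

lemma lattice_points_add_gvec:
  assumes "x \<in> lattice_points" shows "x + gvec i \<in> lattice_points"
proof -
  obtain z where z: "x = P z" "\<forall>i. z $ i \<in> \<int>"
    using assms unfolding lattice_points_def by blast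
  have "x + gvec i = P (z + axis i 1)" by (simp add: z P_add gvec_def)
  moreover have "\<forall>j. (z + axis i 1) $ j \<in> \<int>" using z by (auto simp: axis_def)
  ultimately show ?thesis unfolding lattice_points_def by blast
qed

lemma lattice_points_add_steps:
  "x \<in> lattice_points \<Longrightarrow> x + sum_list (map gvec xs) \<in> lattice_points"
proof (induction xs arbitrary: x)
  case (Cons i xs)
  then show ?case using Cons.IH[OF lattice_points_add_gvec, of x i] by (simp add: add.assoc)
qed simp

lemma ex_mset_count: "\<exists>xs. \<forall>i. count (mset xs) i = h i" for h :: "'n::finite \<Rightarrow> nat"
  by (metis count_Abs_multiset ex_mset finite)

text \<open>Adding a multiple of \<^const>\<open>nvec\<close> makes all coordinates nonnegative, so forward steps suffice.\<close>

lemma lattice_point_steps: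
  fixes x :: "real^'n"
  assumes "x \<in> lattice_points"
  shows "\<exists>xs. sum_list (map gvec xs) = x"
proof -
  obtain z where z: "x = P z" "\<forall>i. z $ i \<in> \<int>"
    using assms unfolding lattice_points_def by blast
  have "\<forall>i. \<exists>k. z $ i = of_int k" using z(2) by (auto elim: Ints_cases)
  then obtain c where c: "\<And>i. z $ i = of_int (c i)" by metis
  \<comment> \<open>A crude shift that makes every \<open>c i + m\<close> nonnegative at once; the
    multiple of \<open>nvec\<close> it adds is removed again by the projection.\<close>
  define m where "m = (\<Sum>i\<in>UNIV. \<bar>c i\<bar>)"
  have m: "c i + m \<ge> 0" for i
    using member_le_sum[of i UNIV "\<lambda>i. \<bar>c i\<bar>"] unfolding m_def by simp
  obtain xs where xs: "\<And>i. count (mset xs) i = nat (c i + m)"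
    using ex_mset_count[of "\<lambda>i. nat (c i + m)"] by blast
  have "length xs = (\<Sum>i\<in>UNIV. count (mset xs) i)"
    unfolding size_mset[symmetric] size_multiset_overloaded_eq
    by (rule sum.mono_neutral_left) (auto simp: not_in_iff)
  then have "real (length xs) = (\<Sum>i\<in>UNIV. of_int (c i + m))"
    using m by (simp add: xs)
  also have "\<dots> = (\<Sum>i\<in>UNIV. z $ i) + real CARD('n) * of_int m"
    by (simp add: sum.distrib c)
  finally have len: "real (length xs) = (\<Sum>i\<in>UNIV. z $ i) + real CARD('n) * of_int m" .
  have "sum_list (map gvec xs) $ j = x $ j" for j
    using m by (simp add: steps_nth z(1) P_nth len xs c add_divide_distrib)
  then show ?thesis by (auto simp: vec_eq_iff)
qed

lemma sum_gvec: "(\<Sum>i\<in>UNIV. gvec i) = (0 :: real^'n)"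
  by (simp add: vec_eq_iff gvec_nth sum_subtractf)

lemma full_steps:
  assumes "distinct xs" "set xs = (UNIV :: 'n::finite set)"
  shows "sum_list (map gvec xs) = (0 :: real^'n)" "length xs = CARD('n)"
  using assms sum_gvec by (metis sum_list_distinct_conv_sum_set, metis distinct_card)

section \<open>Potentials\<close>

text \<open>A path is a start and a list of directions, traversed forwards only. So \<open>w\<close>
  takes the tail of a step and its direction, and no sign convention for backward steps
  arises.\<close>

fun path_weight :: "(real^'n \<Rightarrow> 'n \<Rightarrow> int) \<Rightarrow> real^'n \<Rightarrow> 'n list \<Rightarrow> int" where
  "path_weight w x [] = 0"
| "path_weight w x (i # xs) = w x i + path_weight w (x + gvec i) xs"

lemma path_weight_append:
  "path_weight w x (xs @ ys) = path_weight w x xs + path_weight w (x + sum_list (map gvec xs)) ys"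
  by (induction xs arbitrary: x) (auto simp: add.assoc)

lemma path_weight_eq_sum:
  "path_weight w x xs = (\<Sum>k<length xs. w (x + sum_list (map gvec (take k xs))) (xs ! k))"
proof (induction xs arbitrary: x)
  case (Cons i xs)
  then show ?case
    by (simp add: sum.lessThan_Suc_shift add.assoc del: sum.lessThan_Suc)
qed simp

text \<open>A distinct list of all directions traces a simplicial loop, so the assumption is a
  discrete analogue of a closed 1-form.\<close>

locale loop_free_weight =
  fixes w :: "real^'n \<Rightarrow> 'n \<Rightarrow> int"
  assumes full: "\<lbrakk>x \<in> lattice_points; distinct xs; set xs = UNIV\<rbrakk> \<Longrightarrow> path_weight w x xs = 0"
begin

lemma swap:
  assumes x: "x \<in> lattice_points"
  shows "w x i + w (x + gvec i) j = w x j + w (x + gvec j) i"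
proof (cases "i = j")
  case False
  \<comment> \<open>\<open>r\<close> is the common tail of the loops \<open>i # j # r\<close> and
    \<open>j # i # r\<close>. It starts at the same point in both, so its weight cancels.\<close>
  obtain r where r: "set r = UNIV - {i, j}" "distinct r"
    using finite_distinct_list[of "UNIV - {i, j}"] by auto
  have "path_weight w x (i # j # r) = 0" "path_weight w x (j # i # r) = 0"
    by (rule full[OF x]; use r False in auto)+
  moreover have "x + gvec i + gvec j = x + gvec j + gvec i" by (simp add: add_ac)
  ultimately show ?thesis by simp
qed simp

text \<open>The step \<open>i\<close> moves left past \<open>ys\<close>, one \<open>swap\<close> at
  a time.\<close>

lemma to_front:
  "x \<in> lattice_points \<Longrightarrow> path_weight w x (ys @ i # zs) = path_weight w x (i # ys @ zs)"
proof (induction ys arbitrary: x)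
  case (Cons j ys)
  then have "path_weight w x ((j # ys) @ i # zs) =
      w x j + path_weight w (x + gvec j) (i # ys @ zs)"
    using Cons.IH[OF lattice_points_add_gvec] by simp
  then show ?case using swap[OF Cons.prems, of i j] by (simp add: add_ac)
qed simp

text \<open>The head of \<open>xs\<close> occurs in \<open>ys\<close>; \<open>to_front\<close>
  brings it to the head there, and the tails are compared from the next point.\<close>

lemma path_weight_mset:
  "x \<in> lattice_points \<Longrightarrow> mset xs = mset ys \<Longrightarrow> path_weight w x xs = path_weight w x ys"
proof (induction xs arbitrary: x ys)
  case (Cons i xs)
  then have "i \<in> set ys" by (metis list.set_intros(1) mset_eq_setD)
  then obtain ys1 ys2 where ys: "ys = ys1 @ i # ys2" by (meson split_list)
  have "path_weight w (x + gvec i) xs = path_weight w (x + gvec i) (ys1 @ ys2)"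
    by (rule Cons.IH) (use Cons.prems ys lattice_points_add_gvec in simp_all)
  then show ?case using Cons.prems to_front ys by simp
qed simp

lemma path_weight_replicate:
  assumes "x \<in> lattice_points" "distinct r" "set r = UNIV"
  shows "path_weight w x (concat (replicate k r)) = 0"
proof (induction k)
  case (Suc k)
  have "path_weight w x (r @ concat (replicate k r)) = 0"
    unfolding path_weight_append full[OF assms] full_steps(1)[OF assms(2,3)]
    using Suc by simp
  then show ?case by simp
qed simp

text \<open>Equal endpoints force the multiplicities of all directions to differ by one constant
  \<open>c\<close>, nonnegative by \<open>len\<close>. Hence \<open>xs\<close> rearranges
  \<open>ys\<close> followed by \<open>c\<close> full loops, each of weight
  \<open>0\<close>.\<close>

lemma path_weight_closed:
  fixes xs ys :: "'n list"
  assumes x: "x \<in> lattice_points"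
    and eq: "sum_list (map gvec xs) = (sum_list (map gvec ys) :: real^'n)"
    and len: "length ys \<le> length xs"
  shows "path_weight w x xs = path_weight w x ys"
proof -
  define c where "c = (real (length xs) - real (length ys)) / real CARD('n)"
  have c: "real (count (mset xs) i) = real (count (mset ys) i) + c" for i
    using arg_cong[OF eq, of "\<lambda>v. v $ i"] by (simp add: steps_nth c_def diff_divide_distrib)
  have "c \<ge> 0" using len by (simp add: c_def)
  \<comment> \<open>\<open>undefined\<close> is just some direction: \<open>c\<close> does not
    depend on it, so one coordinate already shows that \<open>c\<close> is a natural number.\<close>
  define k where "k = count (mset xs) undefined - count (mset ys) undefined"
  have "c = real k"
    using c[of undefined] \<open>c \<ge> 0\<close> by (simp add: k_def of_nat_diff)
  then have k: "count (mset xs) i = count (mset ys) i + k" for i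
    using c[of i] by (metis of_nat_add of_nat_eq_iff)
  obtain r :: "'n list" where r: "set r = UNIV" "distinct r"
    using finite_distinct_list[OF finite] by blast
  have "count (mset (concat (replicate k r))) i = k" for i
    using r by (induction k) (auto simp: distinct_count_atmost_1)
  then have "mset xs = mset (ys @ concat (replicate k r))"
    by (intro multiset_eqI) (simp add: k)
  then have "path_weight w x xs = path_weight w x (ys @ concat (replicate k r))"
    by (rule path_weight_mset[OF x])
  then show ?thesis
    using path_weight_replicate[OF lattice_points_add_steps[OF x] r(2,1)]
    by (simp add: path_weight_append)
qed

lemma ex_potential:
  "\<exists>f \<in> extensional lattice_points. f 0 = a \<and>
     (\<forall>x\<in>lattice_points. \<forall>i. f (x + gvec i) - f x = w x i)"
proof -
  define path where "path x = (SOME xs. sum_list (map gvec xs) = x)" for x :: "real^'n"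
  have path: "sum_list (map gvec (path x)) = x" if "x \<in> lattice_points" for x
    unfolding path_def using someI_ex[OF lattice_point_steps[OF that]] .
  \<comment> \<open>Either path may be the longer one, hence both directions of the
    equation.\<close>
  have indep: "path_weight w 0 xs = path_weight w 0 ys"
    if "sum_list (map gvec xs) = (sum_list (map gvec ys) :: real^'n)" for xs ys
    using path_weight_closed[OF zero_in_lattice_points that]
      path_weight_closed[OF zero_in_lattice_points that[symmetric]]
    by (metis nat_le_linear)
  define f where "f = restrict (\<lambda>x. a + path_weight w 0 (path x)) lattice_points"
  have "f (x + gvec i) - f x = w x i" if x: "x \<in> lattice_points" for x i
  proof -
    \<comment> \<open>The chosen path to \<open>x + gvec i\<close> need not pass through
      \<open>x\<close>, but it ends where the extended path to \<open>x\<close> ends.\<close>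
    have "path_weight w 0 (path (x + gvec i)) = path_weight w 0 (path x @ [i])"
      by (rule indep) (simp add: path x lattice_points_add_gvec)
    also have "\<dots> = path_weight w 0 (path x) + w x i"
      by (simp add: path_weight_append path x)
    finally show ?thesis by (simp add: f_def x lattice_points_add_gvec)
  qed
  moreover have "f 0 = a"
    using indep[of "path 0" "[]"] path[OF zero_in_lattice_points]
    by (simp add: f_def zero_in_lattice_points)
  ultimately show ?thesis by (intro bexI[of _ f]) (auto simp: f_def)
qed

end

section \<open>Height functions and tilings\<close>

text \<open>An edge determines its direction by \<open>edge_orientation\<close>, and a loop uses
  each direction once. With only two directions a loop would traverse one edge twice.\<close>

lemma loop_edges_card:
  fixes s :: "nat \<Rightarrow> real^'n"
  assumes card: "CARD('n) \<ge> 3" and s: "simplicial_loop s"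
  shows "inj_on (\<lambda>k. {s (k - 1), s k}) {1..CARD('n)}" "finite (loop_edges s)"
    "card (loop_edges s) = CARD('n)"
proof -
  obtain \<xi> where \<xi>: "bij_betw \<xi> {1..CARD('n)} (UNIV :: 'n set)"
    "\<And>k. k \<in> {1..CARD('n)} \<Longrightarrow> s k = s (k - 1) + gvec (\<xi> k)"
    using s unfolding simplicial_loop_def by blast
  show inj: "inj_on (\<lambda>k. {s (k - 1), s k}) {1..CARD('n)}"
  proof (rule inj_onI)
    fix k l assume k: "k \<in> {1..CARD('n)}" and l: "l \<in> {1..CARD('n)}"
      and "{s (k - 1), s k} = {s (l - 1), s l}"
    then have "\<xi> k = \<xi> l" using edge_orientation[OF card] \<xi>(2) by metis
    then show "k = l" using \<xi>(1) k l by (metis bij_betw_imp_inj_on inj_onD)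
  qed
  have "loop_edges s = (\<lambda>k. {s (k - 1), s k}) ` {1..CARD('n)}"
    unfolding loop_edges_def by auto
  with inj show "finite (loop_edges s)" "card (loop_edges s) = CARD('n)"
    by (auto simp: card_image)
qed

text \<open>The increment, along a step \<open>gvec i\<close>, of a height function with tiling
  \<open>T\<close>. It can be a function of the undirected edge because the edge determines the
  forward direction.\<close>

definition edge_weight :: "(real^'n) set set \<Rightarrow> (real^'n) set \<Rightarrow> int" where
  "edge_weight T e = (if e \<in> T then - (int CARD('n) - 1) else 1)"

text \<open>Each weight is \<open>1\<close>, minus \<open>CARD('n)\<close> if the edge lies in
  \<open>T\<close>. With \<open>m\<close> loop edges in \<open>T\<close> the total is
  \<open>CARD('n) * (1 - m)\<close>, which vanishes exactly for \<open>m = 1\<close>.\<close>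

lemma sum_edge_weight_eq_0_iff:
  fixes s :: "nat \<Rightarrow> real^'n"
  assumes card: "CARD('n) \<ge> 3" and s: "simplicial_loop s"
  shows "(\<Sum>k=1..CARD('n). edge_weight T {s (k - 1), s k}) = 0 \<longleftrightarrow>
    (\<exists>!e. e \<in> loop_edges s \<and> e \<in> T)"
proof -
  let ?n = "int CARD('n)"
  have "loop_edges s = (\<lambda>k. {s (k - 1), s k}) ` {1..CARD('n)}"
    unfolding loop_edges_def by auto
  then have "(\<Sum>k=1..CARD('n). edge_weight T {s (k - 1), s k}) = (\<Sum>e\<in>loop_edges s. edge_weight T e)"
    using loop_edges_card(1)[OF card s] by (simp add: sum.reindex)
  also have "\<dots> = (\<Sum>e\<in>loop_edges s. 1 - (if e \<in> T then ?n else 0))"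
    by (rule sum.cong) (auto simp: edge_weight_def)
  also have "\<dots> = ?n * (1 - int (card (loop_edges s \<inter> T)))"
    using loop_edges_card(2,3)[OF card s]
    by (simp add: sum_subtractf sum.If_cases Int_def algebra_simps)
  finally have "(\<Sum>k=1..CARD('n). edge_weight T {s (k - 1), s k}) = 0 \<longleftrightarrow>
      card (loop_edges s \<inter> T) = 1" by simp
  also have "\<dots> \<longleftrightarrow> (\<exists>!e. e \<in> loop_edges s \<and> e \<in> T)"
    unfolding One_nat_def card_1_singleton_iff by auto
  finally show ?thesis .
qed

lemma edge_in_tiling_of:
  fixes f :: "real^'n \<Rightarrow> int"
  assumes "CARD('n) \<ge> 3" "x \<in> lattice_points"
  shows "{x, x + gvec i} \<in> tiling_of f \<longleftrightarrow> f (x + gvec i) - f x = - (int CARD('n) - 1)"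
proof
  assume "{x, x + gvec i} \<in> tiling_of f"
  then obtain y j where y: "{x, x + gvec i} = {y, y + gvec j}"
    "f (y + gvec j) - f y = - (int CARD('n) - 1)"
    unfolding tiling_of_def by blast
  then show "f (x + gvec i) - f x = - (int CARD('n) - 1)"
    using edge_orientation[OF assms(1) y(1)] by simp
qed (use assms(2) in \<open>auto simp: tiling_of_def\<close>)

lemma height_function_gradient:
  fixes f :: "real^'n \<Rightarrow> int"
  assumes "CARD('n) \<ge> 3" "f \<in> height_functions" "x \<in> lattice_points"
  shows "f (x + gvec i) - f x = edge_weight (tiling_of f) {x, x + gvec i}"
proof -
  have "f (x + gvec i) - f x \<in> {1, - (int CARD('n) - 1)}"
    using assms unfolding height_functions_def by blast
  then show ?thesis using edge_in_tiling_of[OF assms(1,3)] by (auto simp: edge_weight_def)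
qed

text \<open>The increments of \<open>f\<close> telescope to \<open>0\<close> around a loop, which is
  the criterion for exactly one tiling edge.\<close>

lemma tiling_of_in_tilings:
  fixes f :: "real^'n \<Rightarrow> int"
  assumes card: "CARD('n) \<ge> 3" and f: "f \<in> height_functions"
  shows "tiling_of f \<in> tilings"
proof -
  have "\<exists>!e. e \<in> loop_edges s \<and> e \<in> tiling_of f" if s: "simplicial_loop s" for s
  proof -
    have "edge_weight (tiling_of f) {s (k - 1), s k} = f (s k) - f (s (k - 1))"
      if k: "k \<in> {1..CARD('n)}" for k
    proof -
      have "s (k - 1) \<in> lattice_points" using s k unfolding simplicial_loop_def by auto
      moreover obtain i where "s k = s (k - 1) + gvec i"
        using s k unfolding simplicial_loop_def by blast
      ultimately show ?thesis using height_function_gradient[OF card f] by metis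
    qed
    then have "(\<Sum>k=1..CARD('n). edge_weight (tiling_of f) {s (k - 1), s k}) =
        (\<Sum>k=1..CARD('n). f (s k) - f (s (k - 1)))"
      by (rule sum.cong[OF refl])
    also have "\<dots> = f (s CARD('n)) - f (s 0)"
      using sum_telescope''[of 0 "CARD('n)" "\<lambda>k. f (s k)"] by simp
    also have "\<dots> = 0" using s unfolding simplicial_loop_def by simp
    finally show ?thesis unfolding sum_edge_weight_eq_0_iff[OF card s] .
  qed
  moreover have "tiling_of f \<subseteq> lattice_edges"
    unfolding tiling_of_def lattice_edges_def by blast
  ultimately show ?thesis unfolding tilings_def by blast
qed

lemma tiling_loop_free_weight:
  fixes T :: "(real^'n) set set"
  assumes card: "CARD('n) \<ge> 3" and T: "T \<in> tilings"
  shows "loop_free_weight (\<lambda>x i. edge_weight T {x, x + gvec i})"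
proof
  fix x :: "real^'n" and xs :: "'n list"
  assume x: "x \<in> lattice_points" and xs: "distinct xs" "set xs = UNIV"
  note len = full_steps(2)[OF xs]
  define s where "s k = x + sum_list (map gvec (take k xs))" for k
  have step: "s (Suc k) = s k + gvec (xs ! k)" if "k < length xs" for k
    using that by (simp add: s_def take_Suc_conv_app_nth add.assoc)
  \<comment> \<open>Loop steps are numbered from \<open>1\<close>, list positions from
    \<open>0\<close>.\<close>
  have "bij_betw (\<lambda>k. xs ! (k - 1)) {1..CARD('n)} UNIV"
  proof -
    have "bij_betw ((!) xs) {..<length xs} UNIV"
      using bij_betw_nth[OF xs(1) refl] xs(2) by simp
    moreover have "bij_betw (\<lambda>k. k - 1) {1..length xs} {..<length xs}"
      by (rule bij_betw_byWitness[of _ Suc]) auto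
    ultimately have "bij_betw ((!) xs \<circ> (\<lambda>k. k - 1)) {1..length xs} UNIV"
      by (rule bij_betw_trans[rotated])
    then show ?thesis by (simp add: comp_def len)
  qed
  moreover have "s k = s (k - 1) + gvec (xs ! (k - 1))" if "k \<in> {1..CARD('n)}" for k
    using step[of "k - 1"] that len by (cases k) simp_all
  moreover have "s CARD('n) = s 0"
    using full_steps[OF xs] by (simp add: s_def)
  moreover have "s k \<in> lattice_points" for k
    using lattice_points_add_steps[OF x] by (simp add: s_def)
  ultimately have s: "simplicial_loop s" unfolding simplicial_loop_def by blast
  have "path_weight (\<lambda>x i. edge_weight T {x, x + gvec i}) x xs =
      (\<Sum>k<length xs. edge_weight T {s k, s (Suc k)})"
    unfolding path_weight_eq_sum by (rule sum.cong) (auto simp: step simp flip: s_def)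
  also have "\<dots> = (\<Sum>k=1..CARD('n). edge_weight T {s (k - 1), s k})"
    by (rule sum.reindex_bij_witness[of _ "\<lambda>k. k - 1" Suc]) (auto simp: len)
  also have "\<dots> = 0"
    unfolding sum_edge_weight_eq_0_iff[OF card s] using T s by (simp add: tilings_def)
  finally show "path_weight (\<lambda>x i. edge_weight T {x, x + gvec i}) x xs = 0" .
qed

lemma height_function_steps:
  fixes f :: "real^'n \<Rightarrow> int"
  assumes card: "CARD('n) \<ge> 3" and f: "f \<in> height_functions" and x: "x \<in> lattice_points"
  shows "f (x + sum_list (map gvec xs)) =
    f x + path_weight (\<lambda>x i. edge_weight (tiling_of f) {x, x + gvec i}) x xs"
  using x
proof (induction xs arbitrary: x)
  case (Cons i xs)
  then show ?case
    using height_function_gradient[OF card f, of x i]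
      Cons.IH[OF lattice_points_add_gvec, of x i]
    by (simp add: add.assoc)
qed simp

text \<open>Forward paths from \<open>0\<close> reach every lattice point, so the base value and the
  tiling fix \<open>f\<close> on the lattice; extensionality fixes it elsewhere.\<close>

lemma Phi_inj:
  fixes f :: "real^'n \<Rightarrow> int"
  assumes card: "CARD('n) \<ge> 3" and f: "f \<in> height_functions" "f' \<in> height_functions"
    and eq: "Phi f = Phi f'"
  shows "f = f'"
proof (rule extensionalityI)
  show "f \<in> extensional lattice_points" "f' \<in> extensional lattice_points"
    using f unfolding height_functions_def by auto
  fix x :: "real^'n" assume "x \<in> lattice_points"
  then obtain xs where "sum_list (map gvec xs) = x" using lattice_point_steps by blast
  then show "f x = f' x"
    using height_function_steps[OF card f(1) zero_in_lattice_points, of xs]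
      height_function_steps[OF card f(2) zero_in_lattice_points, of xs] eq
    by (simp add: Phi_def)
qed

text \<open>Existence is the potential of the edge weights of \<open>T\<close> with value
  \<open>a\<close> at \<open>0\<close>. Its tiling is \<open>T\<close> because the two possible
  weights are distinct.\<close>

lemma Phi_ex1:
  fixes T :: "(real^'n) set set"
  assumes card: "CARD('n) \<ge> 3" and T: "T \<in> tilings" and a: "int CARD('n) dvd a"
  shows "\<exists>!f. f \<in> height_functions \<and> Phi f = (a, T)"
proof -
  interpret loop_free_weight "\<lambda>x i. edge_weight T {x, x + gvec i}"
    using tiling_loop_free_weight[OF card T] .
  obtain f where f: "f \<in> extensional lattice_points" "f 0 = a"
    "\<And>x i. x \<in> lattice_points \<Longrightarrow> f (x + gvec i) - f x = edge_weight T {x, x + gvec i}"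
    using ex_potential by blast
  have hf: "f \<in> height_functions"
    using f a by (auto simp: height_functions_def edge_weight_def)
  have "{x, x + gvec i} \<in> tiling_of f \<longleftrightarrow> {x, x + gvec i} \<in> T" if "x \<in> lattice_points" for x i
    using edge_in_tiling_of[OF card that] f(3)[OF that] card by (auto simp: edge_weight_def)
  moreover have "T \<subseteq> lattice_edges" "tiling_of f \<subseteq> lattice_edges"
    using T tiling_of_in_tilings[OF card hf] unfolding tilings_def by auto
  ultimately have "tiling_of f = T" unfolding lattice_edges_def by blast
  then have "Phi f = (a, T)" by (simp add: Phi_def f)
  then show ?thesis using hf Phi_inj[OF card] by metis
qed

section \<open>Unions of boundaries\<close>

lemma equiv_connected:
  "equiv A {(u, v). u \<in> A \<and> v \<in> A \<and> (u, v) \<in> {(a, b). {a, b} \<in> B}\<^sup>*}"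
proof (rule equivI)
  have "sym {(a, b). {a, b} \<in> B}" by (auto simp: sym_def insert_commute)
  then have "sym ({(a, b). {a, b} \<in> B}\<^sup>*)" by (rule sym_rtrancl)
  then show "sym {(u, v). u \<in> A \<and> v \<in> A \<and> (u, v) \<in> {(a, b). {a, b} \<in> B}\<^sup>*}"
    by (auto simp: sym_def)
  show "trans {(u, v). u \<in> A \<and> v \<in> A \<and> (u, v) \<in> {(a, b). {a, b} \<in> B}\<^sup>*}"
    by (auto simp: trans_def)
qed (auto simp: refl_on_def)

lemma connected_comps_subset: "C \<in> connected_comps G \<Longrightarrow> C \<subseteq> fst G"
  unfolding connected_comps_def quotient_def by auto

lemma connected_comps_disj:
  "C \<in> connected_comps G \<Longrightarrow> D \<in> connected_comps G \<Longrightarrow> C = D \<or> C \<inter> D = {}"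
  unfolding connected_comps_def by (rule quotient_disj[OF equiv_connected])

lemma connected_comps_closed:
  assumes "C \<in> connected_comps G" "u \<in> C" "{u, v} \<in> snd G" "v \<in> fst G"
  shows "v \<in> C"
proof -
  have "u \<in> fst G" using connected_comps_subset assms by blast
  then have "(u, v) \<in> {(u, v). u \<in> fst G \<and> v \<in> fst G \<and> (u, v) \<in> {(a, b). {a, b} \<in> snd G}\<^sup>*}"
    using assms by auto
  then show ?thesis
    by (rule in_quotient_imp_closed[OF equiv_connected assms(1)[unfolded connected_comps_def] assms(2)])
qed

text \<open>Of boundaries, only \<open>closed\<close> matters: once \<open>M\<close> meets a loop,
  it contains every edge of that loop in the symmetric difference. The hypotheses are symmetric in
  the two tilings, so the lemma serves both.\<close>

lemma sym_diff_in_tilings: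
  assumes T1: "T1 \<in> tilings" and T2: "T2 \<in> tilings" and M: "M \<subseteq> sym_diff T1 T2"
    and closed: "\<And>s e e'. \<lbrakk>simplicial_loop s; e \<in> loop_edges s; e' \<in> loop_edges s;
      e \<in> M; e' \<in> sym_diff T1 T2\<rbrakk> \<Longrightarrow> e' \<in> M"
  shows "sym_diff T1 M \<in> tilings"
proof -
  have "\<exists>!e. e \<in> loop_edges s \<and> e \<in> sym_diff T1 M" if s: "simplicial_loop s" for s
  proof -
    have "\<exists>!e. e \<in> loop_edges s \<and> e \<in> T1" using T1 s unfolding tilings_def by simp
    then obtain e1 where e1: "e1 \<in> loop_edges s" "e1 \<in> T1"
      "\<And>e. e \<in> loop_edges s \<Longrightarrow> e \<in> T1 \<Longrightarrow> e = e1" by blast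
    have "\<exists>!e. e \<in> loop_edges s \<and> e \<in> T2" using T2 s unfolding tilings_def by simp
    then obtain e2 where e2: "e2 \<in> loop_edges s" "e2 \<in> T2"
      "\<And>e. e \<in> loop_edges s \<Longrightarrow> e \<in> T2 \<Longrightarrow> e = e2" by blast
    note c = closed[OF s]
    show ?thesis
    proof (cases "e1 \<in> M")
      \<comment> \<open>Here \<open>e1\<close> leaves the tiling and \<open>e2\<close> replaces
        it.\<close>
      case True
      then have "e1 \<noteq> e2" using M e1(2) e2(2) by blast
      then have "e2 \<notin> T1" using e1(3) e2(1) by blast
      then have "e2 \<in> M" using c[OF e1(1) e2(1) True] e2(2) by blast
      show ?thesis
      proof (rule ex1I[of _ e2])
        show "e2 \<in> loop_edges s \<and> e2 \<in> sym_diff T1 M"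
          using \<open>e2 \<in> M\<close> \<open>e2 \<notin> T1\<close> e2(1) by blast
        show "e = e2" if "e \<in> loop_edges s \<and> e \<in> sym_diff T1 M" for e
          using that True M e1(3) e2(3) by blast
      qed
    next
      case False
      \<comment> \<open>Otherwise \<open>closed\<close> would put \<open>e1\<close> into
        \<open>M\<close> as well. So the loop keeps \<open>e1\<close>.\<close>
      have "e2 \<notin> M"
      proof
        assume "e2 \<in> M"
        then have "e1 \<noteq> e2" using False by blast
        then have "e1 \<notin> T2" using e1(1) e2(3) by blast
        then show False using False c[OF e2(1) e1(1) \<open>e2 \<in> M\<close>] e1(2) by blast
      qed
      show ?thesis
      proof (rule ex1I[of _ e1])
        show "e1 \<in> loop_edges s \<and> e1 \<in> sym_diff T1 M" using False e1 by blast
        show "e = e1" if "e \<in> loop_edges s \<and> e \<in> sym_diff T1 M" for e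
          using that \<open>e2 \<notin> M\<close> M e1(3) e2(3) by blast
      qed
    qed
  qed
  moreover have "sym_diff T1 M \<subseteq> lattice_edges"
    using T1 T2 M unfolding tilings_def by blast
  ultimately show ?thesis unfolding tilings_def by blast
qed

section \<open>Endpoints of boundary edges and the level set graph\<close>

lemma xminus_doubleton: "g x < g y \<Longrightarrow> xminus g {x, y} = x"
  unfolding xminus_def arg_min_def is_arg_min_def by (rule some_equality) auto

lemma xplus_doubleton: "g x < g y \<Longrightarrow> xplus g {x, y} = y"
  unfolding xplus_def arg_max_def is_arg_max_def by (rule some_equality) auto

lemma V_cases:
  assumes "e \<in> V g"
  obtains x y where "e = {x, y}" "g x < g y" "e \<in> lattice_edges"
proof -
  obtain x y where xy: "e = {x, y}" "e \<in> lattice_edges" "g x \<noteq> g y"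
    using assms unfolding V_def lattice_edges_def constant_on_def by auto
  then show ?thesis using that by (metis insert_commute linorder_neqE)
qed

lemma V_iff: "{x, y} \<in> V g \<longleftrightarrow> {x, y} \<in> lattice_edges \<and> g x \<noteq> g y"
  by (auto simp: V_def constant_on_def)

text \<open>
  Reversing a boundary exchanges its two endpoints in the level set graph, which the unordered
  incidence relation does not see.
\<close>

lemma LSD_reverse:
  assumes S: "S \<subseteq> boundaries g" and M: "M = \<Union>S"
    and grad: "\<And>x y. {x, y} \<in> lattice_edges \<Longrightarrow>
      g' y - g' x = (if {x, y} \<in> M then - (g y - g x) else g y - g x)"
  shows "boundary_graph g' = boundary_graph g" "LSD g' = LSD g"
proof -
  \<comment> \<open>Membership in \<open>V\<close> only asks whether the increment is nonzero, so
    signs are irrelevant.\<close>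
  have "e \<in> V g' \<longleftrightarrow> e \<in> V g" for e
  proof (cases "e \<in> lattice_edges")
    case True
    then obtain x y where e: "e = {x, y}" unfolding lattice_edges_def by blast
    then show ?thesis using grad[of x y] True by (auto simp: V_iff split: if_splits)
  qed (simp add: V_def)
  then have V: "V g' = V g" by blast
  then show bg: "boundary_graph g' = boundary_graph g" by (simp add: boundary_graph_def)
  then have b: "boundaries g' = boundaries g" by (simp add: boundaries_def)
  have l: "level_sets g' = level_sets g" by (simp add: level_sets_def V)
  have ends: "xminus g' e = (if e \<in> M then xplus g e else xminus g e)"
    "xplus g' e = (if e \<in> M then xminus g e else xplus g e)" if "e \<in> V g" for e
  proof -
    obtain x y where e: "e = {x, y}" "g x < g y" "e \<in> lattice_edges"
      using V_cases[OF \<open>e \<in> V g\<close>] .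
    have "e = {y, x}" using e by auto
    then show "xminus g' e = (if e \<in> M then xplus g e else xminus g e)"
      "xplus g' e = (if e \<in> M then xminus g e else xplus g e)"
      using e grad[of x y] xminus_doubleton[of g x y] xplus_doubleton[of g x y]
        xminus_doubleton[of g' x y] xplus_doubleton[of g' x y]
        xminus_doubleton[of g' y x] xplus_doubleton[of g' y x]
      by (auto split: if_splits)
  qed
  \<comment> \<open>Components are disjoint, so each boundary lies inside \<open>M\<close> or misses
    it; hence the exchange of endpoints affects all of its edges or none.\<close>
  have images: "xminus g' ` E = xplus g ` E \<and> xplus g' ` E = xminus g ` E \<or>
      xminus g' ` E = xminus g ` E \<and> xplus g' ` E = xplus g ` E"
    if E: "E \<in> boundaries g" for E
  proof -
    have sub: "E \<subseteq> V g"
      using E connected_comps_subset by (fastforce simp: boundaries_def boundary_graph_def)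
    have "E \<subseteq> M \<or> E \<inter> M = {}"
    proof (cases "E \<in> S")
      case False
      then show ?thesis
        using E S connected_comps_disj[of E "boundary_graph g"] unfolding M boundaries_def by blast
    qed (auto simp: M)
    then show ?thesis
    proof
      assume "E \<subseteq> M"
      then have "xminus g' e = xplus g e" "xplus g' e = xminus g e" if "e \<in> E" for e
        using that ends[OF subsetD[OF sub that]] \<open>E \<subseteq> M\<close> by auto
      then show ?thesis by (simp cong: image_cong)
    next
      assume "E \<inter> M = {}"
      then have "xminus g' e = xminus g e" "xplus g' e = xplus g e" if "e \<in> E" for e
        using that ends[OF subsetD[OF sub that]] \<open>E \<inter> M = {}\<close> by auto
      then show ?thesis by (simp cong: image_cong)
    qed
  qed
  \<comment> \<open>Isolates incidence as a relation in the two endpoint images, so that its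
    symmetry in \<open>X\<close> and \<open>Y\<close> can be stated.\<close>
  define inc where "inc X Y p \<longleftrightarrow> (\<exists>A B. p = {A, B} \<and> A \<in> level_sets g \<and> B \<in> level_sets g \<and>
      X \<subseteq> A \<and> Y \<subseteq> B)" for X Y p
  have inc_swap: "inc X Y p" if p: "inc Y X p" for X Y p
  proof -
    obtain A B where AB: "p = {A, B}" "A \<in> level_sets g" "B \<in> level_sets g" "Y \<subseteq> A" "X \<subseteq> B"
      using p unfolding inc_def by blast
    have "p = {B, A}" unfolding AB(1) by (rule insert_commute)
    then show ?thesis unfolding inc_def using AB(2-) by blast
  qed
  have LSD: "LSD h = (level_sets g, boundaries g,
      {(E, p). E \<in> boundaries g \<and> inc (xminus h ` E) (xplus h ` E) p})"
    if "level_sets h = level_sets g" "boundaries h = boundaries g" for h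
  proof -
    have "{(E, {A, B}) | E A B. E \<in> boundaries g \<and> A \<in> level_sets g \<and> B \<in> level_sets g \<and>
        xminus h ` E \<subseteq> A \<and> xplus h ` E \<subseteq> B} =
      {(E, p). E \<in> boundaries g \<and> inc (xminus h ` E) (xplus h ` E) p}" (is "?L = ?R")
    proof (rule set_eqI)
      fix q
      show "q \<in> ?L \<longleftrightarrow> q \<in> ?R"
        by (cases q; cases "fst q \<in> boundaries g") (simp_all add: inc_def)
    qed
    then show ?thesis by (simp add: LSD_def that)
  qed
  have "inc (xminus g' ` E) (xplus g' ` E) p \<longleftrightarrow> inc (xminus g ` E) (xplus g ` E) p"
    if "E \<in> boundaries g" for E p
    using images[OF that]
  proof
    assume "xminus g' ` E = xplus g ` E \<and> xplus g' ` E = xminus g ` E"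
    then show ?thesis using inc_swap by metis
  qed simp
  then show "LSD g' = LSD g"
    unfolding LSD[OF l b] LSD[OF refl refl] by auto
qed

section \<open>Reversal of a union of boundaries\<close>

theorem lemma4p6:
  fixes d :: nat
    and f1 f2 g :: "real^'n \<Rightarrow> int"
    and a1 a2 :: int
    and T1 T2 T1' T2' M :: "(real^'n) set set"
  assumes "CARD('n) = d + 1" and "d \<ge> 2"
    and "f1 \<in> height_functions" and "f2 \<in> height_functions"
    and "g = (\<lambda>x. f1 x - f2 x)"
    and "(a1, T1) = Phi f1" and "(a2, T2) = Phi f2"
    and "\<exists>S \<subseteq> boundaries g. M = \<Union>S"
    and "T1' = sym_diff T1 M" and "T2' = sym_diff T2 M"
  shows "T1' \<in> tilings \<and> T2' \<in> tilings \<and>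
    (\<exists>!f. f \<in> height_functions \<and> Phi f = (a1, T1')) \<and>
    (\<exists>!f. f \<in> height_functions \<and> Phi f = (a2, T2')) \<and>
    (\<forall>f1'\<in>height_functions. \<forall>f2'\<in>height_functions. \<forall>g'.
      Phi f1' = (a1, T1') \<longrightarrow> Phi f2' = (a2, T2') \<longrightarrow> g' = (\<lambda>x. f1' x - f2' x) \<longrightarrow>
        boundary_graph g' = boundary_graph g \<and>
        LSD g' = LSD g \<and>
        (\<forall>x y. {x, y} \<in> lattice_edges \<longrightarrow>
          g' y - g' x = (if {x, y} \<in> M then - (g y - g x) else g y - g x)))"
proof -
  have card: "CARD('n) \<ge> 3" using assms(1,2) by simp
  note f = assms(3,4) and g = assms(5)
  have T: "T1 = tiling_of f1" "T2 = tiling_of f2" and a: "a1 = f1 0" "a2 = f2 0"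
    using assms(6,7) by (auto simp: Phi_def)
  have tilings: "T1 \<in> tilings" "T2 \<in> tilings"
    using tiling_of_in_tilings[OF card] f T by auto
  have V: "V g = sym_diff T1 T2" unfolding g T by (rule V_diff_eq[OF card f])
  obtain S where S: "S \<subseteq> boundaries g" "M = \<Union>S" using assms(8) by blast
  have MV: "M \<subseteq> V g"
    using S connected_comps_subset unfolding boundaries_def
    by (fastforce simp: boundary_graph_def)
  \<comment> \<open>Two distinct edges of \<open>V g\<close> on one loop are adjacent in the
    boundary graph, so they lie in the same member of \<open>S\<close>.\<close>
  have closed: "e' \<in> M"
    if s: "simplicial_loop s" and e: "e \<in> loop_edges s" "e' \<in> loop_edges s" "e \<in> M" "e' \<in> V g"
    for s e e'
  proof (cases "e = e'")
    case False
    obtain E where E: "E \<in> S" "e \<in> E" using e S by blast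
    have "{e, e'} \<in> snd (boundary_graph g)"
      using s e False MV by (auto simp: boundary_graph_def)
    then have "e' \<in> E"
      using connected_comps_closed[of E "boundary_graph g" e e'] E S e
      by (auto simp: boundaries_def boundary_graph_def)
    then show ?thesis using E S by blast
  qed (use e in simp)
  have T1': "T1' \<in> tilings"
    unfolding assms(9)
    using MV closed unfolding V by (rule sym_diff_in_tilings[OF tilings])
  have V': "V g = sym_diff T2 T1" using V by blast
  have T2': "T2' \<in> tilings"
    unfolding assms(10)
    using MV closed unfolding V' by (rule sym_diff_in_tilings[OF tilings(2,1)])
  have dvd: "int CARD('n) dvd a1" "int CARD('n) dvd a2"
    using f unfolding a height_functions_def by auto
  have rest: "boundary_graph g' = boundary_graph g \<and> LSD g' = LSD g \<and>
        (\<forall>x y. {x, y} \<in> lattice_edges \<longrightarrow>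
          g' y - g' x = (if {x, y} \<in> M then - (g y - g x) else g y - g x))"
    if f': "f1' \<in> height_functions" "f2' \<in> height_functions"
      and Phi: "Phi f1' = (a1, T1')" "Phi f2' = (a2, T2')"
      and g': "g' = (\<lambda>x. f1' x - f2' x)" for f1' f2' g'
  proof -
    have T': "tiling_of f1' = T1'" "tiling_of f2' = T2'" using Phi by (auto simp: Phi_def)
    have grad: "g' (x + gvec i) - g' x =
        (if {x, x + gvec i} \<in> M then - (g (x + gvec i) - g x) else g (x + gvec i) - g x)"
      if x: "x \<in> lattice_points" for x i
    proof -
      let ?e = "{x, x + gvec i}"
      have "g' (x + gvec i) - g' x = edge_weight T1' ?e - edge_weight T2' ?e"
        using height_function_gradient[OF card f'(1) x, of i]
          height_function_gradient[OF card f'(2) x, of i] by (simp add: g' T')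
      moreover have "g (x + gvec i) - g x = edge_weight T1 ?e - edge_weight T2 ?e"
        using height_function_gradient[OF card f(1) x, of i]
          height_function_gradient[OF card f(2) x, of i] by (simp add: g T)
      \<comment> \<open>On \<open>M\<close> exactly one of \<open>T1\<close>, \<open>T2\<close>
        contains the edge; toggling exchanges the two weights and negates their difference. Off
        \<open>M\<close> both weights are unchanged.\<close>
      moreover have "?e \<in> M \<Longrightarrow> ?e \<in> sym_diff T1 T2" using MV V by blast
      ultimately show ?thesis
        unfolding assms(9,10) by (auto simp: edge_weight_def)
    qed
    have "g' y - g' x = (if {x, y} \<in> M then - (g y - g x) else g y - g x)"
      if xy: "{x, y} \<in> lattice_edges" for x y
    proof -
      obtain u i where u: "u \<in> lattice_points" "{x, y} = {u, u + gvec i}"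
        using xy unfolding lattice_edges_def by blast
      \<comment> \<open>The pair may be read against the forward direction; this negates both sides
        of \<open>grad\<close>.\<close>
      then consider "x = u" "y = u + gvec i" | "x = u + gvec i" "y = u"
        by (auto simp: doubleton_eq_iff)
      then show ?thesis
        using grad[OF u(1), of i] by cases (auto simp: insert_commute split: if_splits)
    qed
    then show ?thesis using LSD_reverse[OF S, of g'] by blast
  qed
  show ?thesis
    using T1' T2' Phi_ex1[OF card T1' dvd(1)] Phi_ex1[OF card T2' dvd(2)] rest by blast
qed

end
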